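(* Let $A\in\mathcal{M}_n(\mathbb{R})$, let $\alpha,\beta\in\mathbb{R}$, let $\mathcal{L}(A,\alpha,\beta)=\alpha H_A+\beta S_A$, and let $\lambda_j\in\sigma(\mathcal{L}(A,\alpha,\beta))$. Then for each $\lambda_j$, $$\left|\operatorname{Re}\lambda_j-\frac{\alpha\,\mathrm{tr}(H_A)}{n}\right|\le|\alpha|\left[\frac{n-1}{n}\left(\|H_A\|_F^2-\frac{\beta^2\|S_AH_A-H_AS_A\|_F^2}{3\left(\alpha^2\|H_A\|_F^2+\beta^2\|S_A\|_F^2\right)}-\frac{[\mathrm{tr}(H_A)]^2}{n}\right)\right]^{1/2}$$ and $$\left|\operatorname{Im}\lambda_j\right|\le|\beta|\left[\frac{n-1}{n}\left(\|S_A\|_F^2-\frac{\alpha^2\|S_AH_A-H_AS_A\|_F^2}{3\left(\alpha^2\|H_A\|_F^2+\beta^2\|S_A\|_F^2\right)}\right)\right]^{1/2},$$ where $\|\cdot\|_F$ denotes the Frobenius norm.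
   Context: $\mathcal{M}_n(\mathbb{R})$ is the algebra of $n\times n$ real matrices, $\sigma(\cdot)$ is the spectrum (complex eigenvalues) and $\mathrm{tr}$ the trace. $H_A=\frac{A+A^*}{2}$ and $S_A=\frac{A-A^*}{2}$ are the Hermitian and skew-Hermitian parts of $A$ (here $A^*=A^T$). $\mathcal{L}(A,\alpha,\beta)$ is called the generalized Levinger transformation of $A$. *)

theory Defs
  imports "Jordan_Normal_Form.Spectral_Radius"
begin

definition mat_trace :: "'a :: comm_monoid_add mat \<Rightarrow> 'a" where
  "mat_trace A = (\<Sum>i<dim_row A. A $$ (i, i))"

definition frob_norm :: "'a :: real_normed_vector mat \<Rightarrow> real" where
  "frob_norm A = sqrt (\<Sum>i<dim_row A. \<Sum>j<dim_col A. (norm (A $$ (i, j)))\<^sup>2)"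

text \<open>All matrices below are real, so the adjoint is the transpose.\<close>

definition herm_part :: "real mat \<Rightarrow> real mat" where
  "herm_part A = (1 / 2) \<cdot>\<^sub>m (A + transpose_mat A)"

definition skew_part :: "real mat \<Rightarrow> real mat" where
  "skew_part A = (1 / 2) \<cdot>\<^sub>m (A - transpose_mat A)"

definition levinger :: "real mat \<Rightarrow> real \<Rightarrow> real \<Rightarrow> real mat" where
  "levinger A \<alpha> \<beta> = \<alpha> \<cdot>\<^sub>m herm_part A + \<beta> \<cdot>\<^sub>m skew_part A"

text \<open>
  The set \<^const>\<open>spectrum\<close> of a \<^typ>\<open>real mat\<close> contains only its real eigenvalues. The
  spectrum meant here consists of the complex eigenvalues of a real matrix, hence the embedding.
\<close>

definition complex_spectrum :: "real mat \<Rightarrow> complex set" where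
  "complex_spectrum A = spectrum (map_mat complex_of_real A)"

end

theory Submission
  imports Defs "HOL-Analysis.Convex"
begin

text \<open>
  Let \<open>L = \<alpha> H + \<beta> S\<close> with eigenvalues \<open>d 0, \<dots>, d (n - 1)\<close>, counted with multiplicity, and let
  \<open>\<delta>\<close> be the squared Frobenius norm of \<open>L\<close> minus the sum of the squared moduli of the eigenvalues.
  This is the (squared) departure of \<open>L\<close> from normality: in a unitary Schur form \<open>D + N\<close> of \<open>L\<close> it
  is the squared norm of the strictly triangular part \<open>N\<close>.

  Since \<open>H\<close> is symmetric and \<open>S\<close> skew-symmetric, the squared norm of \<open>L\<close> is
  \<open>\<alpha>\<^sup>2 \<parallel>H\<parallel>\<^sup>2 + \<beta>\<^sup>2 \<parallel>S\<parallel>\<^sup>2\<close>, whereas \<open>tr (L\<^sup>2) = \<alpha>\<^sup>2 \<parallel>H\<parallel>\<^sup>2 - \<beta>\<^sup>2 \<parallel>S\<parallel>\<^sup>2\<close>. The latter is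
  also the sum of the \<open>(d i)\<^sup>2\<close>. Adding and subtracting gives
    \<open>\<Sum> (Re (d i))\<^sup>2 = \<alpha>\<^sup>2 \<parallel>H\<parallel>\<^sup>2 - \<delta> / 2\<close> and \<open>\<Sum> (Im (d i))\<^sup>2 = \<beta>\<^sup>2 \<parallel>S\<parallel>\<^sup>2 - \<delta> / 2\<close>.

  A matrix far from commuting with its adjoint cannot be close to normal: Eberlein's inequality
  (\<open>eberlein_upper_triangular\<close>) bounds the squared norm of \<open>L L\<^sup>* - L\<^sup>* L\<close> by \<open>6 \<parallel>L\<parallel>\<^sup>2 \<delta>\<close>. Here this
  commutator equals \<open>2 \<alpha> \<beta> (S H - H S)\<close>, so \<open>\<delta> / 2\<close> is at least
  \<open>\<alpha>\<^sup>2 \<beta>\<^sup>2 \<parallel>S H - H S\<parallel>\<^sup>2 / (3 \<parallel>L\<parallel>\<^sup>2)\<close>; taking \<open>\<alpha>\<^sup>2\<close> or \<open>\<beta>\<^sup>2\<close> out leaves the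
  terms that contain the commutator in the two bounds.

  Finally the real parts add up to \<open>\<alpha> tr H\<close> and the imaginary parts to \<open>0\<close>. By the inequality of
  Laguerre and Samuelson (\<open>laguerre_samuelson\<close>) one number out of \<open>n\<close> differs from the mean by at most
  the square root of \<open>(n - 1) / n\<close> times the sum of squared deviations, which gives both bounds.
  The Schur form itself is \<open>unitary_schur\<close>.
\<close>

section \<open>Adjoints and unitary triangularisation\<close>

lemma mat_adjoint_carrier [simp, intro]: "A \<in> carrier_mat n m \<Longrightarrow> mat_adjoint A \<in> carrier_mat m n"
  by (auto simp: mat_adjoint_def)

lemma dim_mat_adjoint [simp]: "dim_row (mat_adjoint A) = dim_col A" "dim_col (mat_adjoint A) = dim_row A"
  by (auto simp: mat_adjoint_def)

lemma index_mat_adjoint [simp]: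
  "i < dim_col A \<Longrightarrow> j < dim_row A \<Longrightarrow> mat_adjoint A $$ (i, j) = conjugate (A $$ (j, i))"
  by (simp add: mat_adjoint_def mat_of_rows_def)

lemma mat_adjoint_adjoint [simp]: "mat_adjoint (mat_adjoint A) = (A :: complex mat)"
  by (rule eq_matI) auto

lemma index_mult_mat_sum:
  "A \<in> carrier_mat n m \<Longrightarrow> B \<in> carrier_mat m k \<Longrightarrow> i < n \<Longrightarrow> j < k
    \<Longrightarrow> (A * B) $$ (i, j) = (\<Sum>l<m. A $$ (i, l) * B $$ (l, j))"
  by (auto simp: scalar_prod_def atLeast0LessThan intro!: sum.cong)

lemma mat_adjoint_mult:
  fixes A B :: "complex mat"
  assumes A: "A \<in> carrier_mat n m" and B: "B \<in> carrier_mat m k"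
  shows "mat_adjoint (A * B) = mat_adjoint B * mat_adjoint A"
proof (rule eq_matI)
  fix i j
  assume "i < dim_row (mat_adjoint B * mat_adjoint A)" "j < dim_col (mat_adjoint B * mat_adjoint A)"
  then have i: "i < k" and j: "j < n" using A B by auto
  have "(A * B) $$ (j, i) = (\<Sum>l<m. A $$ (j, l) * B $$ (l, i))"
    by (rule index_mult_mat_sum[OF A B j i])
  moreover have "(mat_adjoint B * mat_adjoint A) $$ (i, j)
      = (\<Sum>l<m. mat_adjoint B $$ (i, l) * mat_adjoint A $$ (l, j))"
    by (rule index_mult_mat_sum[OF _ _ i j]) (use A B in auto)
  ultimately show "mat_adjoint (A * B) $$ (i, j) = (mat_adjoint B * mat_adjoint A) $$ (i, j)"
    using A B i j by (auto intro!: sum.cong simp: mult.commute)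
qed (use A B in auto)

text \<open>
  Gram-Schmidt in the form of \<^const>\<open>gram_schmidt\<close> yields orthogonal columns only. Unitary
  invariance of the Frobenius norm needs them orthonormal, so they are rescaled here; the first
  column stays a multiple of \<open>v\<close>.
\<close>

lemma orthonormal_completion:
  fixes v :: "complex vec"
  assumes v: "v \<in> carrier_vec n" and v0: "v \<noteq> 0\<^sub>v n" and n: "n \<noteq> 0"
  obtains W c where "W \<in> carrier_mat n n" "mat_adjoint W * W = 1\<^sub>m n" "col W 0 = c \<cdot>\<^sub>v v"
proof -
  interpret cof_vec_space n "TYPE(complex)" .
  define b where "b = basis_completion v"
  define ws where "ws = gram_schmidt n b"
  note bc = basis_completion[OF v v0, folded b_def]
  note gs = gram_schmidt_result[OF bc(2) bc(4) bc(5) ws_def]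
  have len: "length ws = n" using gs(4) bc(6) by simp
  have hd: "hd ws = v" using gram_schmidt_hd[OF v] 
    by (simp add: ws_def b_def basis_completion_def Let_def)
  have w0: "ws ! 0 = v" using hd n len by (metis hd_conv_nth list.size(3))
  have wc: "ws ! i \<in> carrier_vec n" if "i < n" for i
    using gs(3) len that by (metis nth_mem subsetD)
  have orth: "ws ! i \<bullet>c ws ! j = 0 \<longleftrightarrow> i \<noteq> j" if "i < n" "j < n" for i j
    using corthogonalD[OF gs(2)] len that by simp
  have ip: "ws ! j \<bullet>c ws ! i = (\<Sum>k<n. cnj (ws ! i $ k) * ws ! j $ k)" if "i < n" "j < n" for i j
    using wc[OF that(1)] wc[OF that(2)]
    by (auto simp: scalar_prod_def atLeast0LessThan mult.commute intro!: sum.cong)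
  define r where "r i = sqrt (\<Sum>k<n. (cmod (ws ! i $ k))\<^sup>2)" for i
  have rr: "ws ! i \<bullet>c ws ! i = complex_of_real (r i) * complex_of_real (r i)" if "i < n" for i
  proof -
    have "ws ! i \<bullet>c ws ! i = complex_of_real (\<Sum>k<n. (cmod (ws ! i $ k))\<^sup>2)"
      unfolding ip[OF that that] of_real_sum
      by (intro sum.cong refl) (simp add: complex_norm_square[symmetric] mult.commute flip: of_real_power)
    also have "(\<Sum>k<n. (cmod (ws ! i $ k))\<^sup>2) = r i * r i"
      by (simp add: r_def sum_nonneg)
    finally show ?thesis by simp
  qed
  have r0: "complex_of_real (r i) \<noteq> 0" if "i < n" for i
    using rr[OF that] orth[OF that that] by auto
  define W where "W = mat n n (\<lambda>(i, j). ws ! j $ i / complex_of_real (r j))"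
  have Wc: "W \<in> carrier_mat n n" by (simp add: W_def)
  have "mat_adjoint W * W = 1\<^sub>m n"
  proof (rule eq_matI)
    fix i j assume "i < dim_row (1\<^sub>m n :: complex mat)" "j < dim_col (1\<^sub>m n :: complex mat)"
    then have i: "i < n" and j: "j < n" by auto
    have "(mat_adjoint W * W) $$ (i, j) = (\<Sum>k<n. mat_adjoint W $$ (i, k) * W $$ (k, j))"
      by (rule index_mult_mat_sum[OF _ Wc i j]) (use Wc in auto)
    also have "\<dots> = (\<Sum>k<n. cnj (ws ! i $ k) * ws ! j $ k) / (of_real (r i) * of_real (r j))"
      unfolding sum_divide_distrib
      by (intro sum.cong refl) (use i j in \<open>simp add: W_def\<close>)
    also have "\<dots> = (ws ! j \<bullet>c ws ! i) / (of_real (r i) * of_real (r j))"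
      using ip[OF i j] by simp
    also have "\<dots> = 1\<^sub>m n $$ (i, j)"
    proof (cases "i = j")
      case True
      then show ?thesis using i rr[OF i] r0[OF i] by simp
    next
      case False
      then show ?thesis using i j orth[OF j i] by auto
    qed
    finally show "(mat_adjoint W * W) $$ (i, j) = 1\<^sub>m n $$ (i, j)" .
  qed (auto simp: W_def)
  moreover have "col W 0 = (1 / complex_of_real (r 0)) \<cdot>\<^sub>v v"
    by (rule eq_vecI) (use n v w0 in \<open>auto simp: W_def\<close>)
  ultimately show ?thesis using that Wc by blast
qed

text \<open>
  Schur's theorem with a unitary change of basis; the triangularisation by
  \<^const>\<open>schur_decomposition\<close> uses orthogonal columns of arbitrary lengths and need not preserve
  the Frobenius norm. Deflation: in an orthonormal basis that starts with an eigenvector the first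
  column of \<open>A\<close> vanishes below the diagonal, and the remaining diagonal block is triangularised
  by induction.
\<close>

theorem unitary_schur:
  fixes A :: "complex mat"
  assumes "A \<in> carrier_mat n n"
  shows "\<exists>U \<in> carrier_mat n n. mat_adjoint U * U = 1\<^sub>m n \<and> upper_triangular (mat_adjoint U * A * U)"
  using assms
proof (induction n arbitrary: A)
  case 0
  show ?case by (rule bexI[of _ "1\<^sub>m 0"]) (auto intro!: upper_triangularI)
next
  case (Suc m)
  let ?n = "Suc m"
  note A = Suc.prems
  from spectrum_non_empty[OF A] obtain e v where ev: "eigenvector A v e"
    by (auto simp: spectrum_def eigenvalue_def)
  then have v: "v \<in> carrier_vec ?n" "v \<noteq> 0\<^sub>v ?n" and Av: "A *\<^sub>v v = e \<cdot>\<^sub>v v"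
    using A by (auto simp: eigenvector_def)
  obtain W c where W: "W \<in> carrier_mat ?n ?n" and WW: "mat_adjoint W * W = 1\<^sub>m ?n"
    and W0: "col W 0 = c \<cdot>\<^sub>v v"
    using orthonormal_completion[OF v] by blast
  note W' = mat_adjoint_carrier[OF W]
  define A' where "A' = mat_adjoint W * (A * W)"
  have A': "A' \<in> carrier_mat ?n ?n" unfolding A'_def using A W W' by auto
  have AW: "A * W \<in> carrier_mat ?n ?n" using A W by auto
  have AWk: "(A * W) $$ (k, 0) = e * W $$ (k, 0)" if k: "k < ?n" for k
  proof -
    have "(A * W) $$ (k, 0) = (A *\<^sub>v col W 0) $ k"
      using A W k by simp
    also have "A *\<^sub>v col W 0 = e \<cdot>\<^sub>v col W 0"
      unfolding W0 using A v(1) Av by (simp add: mult_mat_vec smult_smult_assoc mult.commute)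
    finally show ?thesis using W k by simp
  qed
  have A'0: "A' $$ (i, 0) = 0" if "i < ?n" "i \<noteq> 0" for i
  proof -
    have "A' $$ (i, 0) = (\<Sum>k<?n. mat_adjoint W $$ (i, k) * (A * W) $$ (k, 0))"
      unfolding A'_def by (rule index_mult_mat_sum[OF W' AW]) (use that in auto)
    also have "\<dots> = e * (\<Sum>k<?n. mat_adjoint W $$ (i, k) * W $$ (k, 0))"
      unfolding sum_distrib_left by (intro sum.cong refl) (simp add: AWk)
    also have "(\<Sum>k<?n. mat_adjoint W $$ (i, k) * W $$ (k, 0)) = (mat_adjoint W * W) $$ (i, 0)"
      by (rule index_mult_mat_sum[OF W' W, symmetric]) (use that in auto)
    finally show ?thesis using that by (simp add: WW)
  qed
  obtain A1 A2 A0 A3 where sp: "split_block A' 1 1 = (A1, A2, A0, A3)"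
    by (cases "split_block A' 1 1") auto
  have dims: "dim_row A' = 1 + m" "dim_col A' = 1 + m" using A' by auto
  note spl = split_block[OF sp dims]
  have A0z: "A0 = 0\<^sub>m m 1"
    using sp A'0 A' by (auto simp: split_block_def Let_def)
  from Suc.IH[OF spl(4)] obtain V where V: "V \<in> carrier_mat m m"
    and VV: "mat_adjoint V * V = 1\<^sub>m m" and Vt: "upper_triangular (mat_adjoint V * A3 * V)" by blast
  \<comment> \<open>In the basis \<open>W\<close>, \<open>F\<close> fixes the eigenvector and acts as \<open>V\<close> on its orthogonal complement.\<close>
  define F where "F = four_block_mat (1\<^sub>m 1) (0\<^sub>m 1 m) (0\<^sub>m m 1) V"
  have F: "F \<in> carrier_mat ?n ?n" unfolding F_def using V four_block_carrier_mat[of "1\<^sub>m 1" 1 1 V m m] by simp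
  note F' = mat_adjoint_carrier[OF F]
  have Fa: "mat_adjoint F = four_block_mat (1\<^sub>m 1) (0\<^sub>m 1 m) (0\<^sub>m m 1) (mat_adjoint V)"
    by (rule eq_matI) (use V in \<open>auto simp: F_def\<close>)
  note V' = mat_adjoint_carrier[OF V]
  have FF: "mat_adjoint F * F = 1\<^sub>m ?n"
    unfolding Fa unfolding F_def
    by (subst mult_four_block_mat[of _ 1 1 _ m _ m _ _ 1 _ m]) 
       (use V V' VV in \<open>auto intro!: eq_matI\<close>)
  have A'F: "A' * F = four_block_mat A1 (A2 * V) (0\<^sub>m m 1) (A3 * V)"
    unfolding spl(5) A0z F_def
    by (subst mult_four_block_mat[of _ 1 1 _ m _ m _ _ 1 _ m]) (use V spl in \<open>auto simp: A0z\<close>)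
  have "mat_adjoint V * (A3 * V) \<in> carrier_mat m m" using V V' spl(4) by auto
  then have FAF: "mat_adjoint F * (A' * F) = four_block_mat A1 (A2 * V) (0\<^sub>m m 1) (mat_adjoint V * A3 * V)"
    unfolding A'F Fa
    by (subst mult_four_block_mat[of _ 1 1 _ m _ m _ _ 1 _ m])
       (use V V' spl in \<open>auto simp: A0z assoc_mult_mat[of _ m m _ m _ m]\<close>)
  have tri: "upper_triangular (mat_adjoint F * (A' * F))"
    unfolding FAF
    by (rule upper_triangular_four_block[OF spl(1) _ _ Vt]) (use V V' spl in \<open>auto intro!: upper_triangularI\<close>)
  define U where "U = W * F"
  have U: "U \<in> carrier_mat ?n ?n" unfolding U_def using W F by auto
  have Ua: "mat_adjoint U = mat_adjoint F * mat_adjoint W"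
    unfolding U_def by (rule mat_adjoint_mult[OF W F])
  note [simp] = assoc_mult_mat[of _ ?n ?n _ ?n _ ?n] mult_carrier_mat[of _ ?n ?n _ ?n]
  have "mat_adjoint U * U = mat_adjoint F * ((mat_adjoint W * W) * F)"
    unfolding Ua unfolding U_def using W W' F F' by simp
  also have "\<dots> = 1\<^sub>m ?n" using F by (simp add: WW FF)
  finally have UU: "mat_adjoint U * U = 1\<^sub>m ?n" .
  have "mat_adjoint U * A * U = mat_adjoint F * (A' * F)"
    unfolding Ua A'_def unfolding U_def using W W' F F' A by simp
  with tri U UU show ?case by auto
qed

section \<open>Trace, Frobenius norm and unitary conjugation\<close>

lemma frob_norm_sq: "(frob_norm A)\<^sup>2 = (\<Sum>i<dim_row A. \<Sum>j<dim_col A. (norm (A $$ (i, j)))\<^sup>2)"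
  unfolding frob_norm_def by (intro real_sqrt_pow2 sum_nonneg) auto

lemma mat_trace_mult:
  assumes "A \<in> carrier_mat n m" "B \<in> carrier_mat m n"
  shows "mat_trace (A * B) = (\<Sum>i<n. \<Sum>k<m. A $$ (i, k) * B $$ (k, i))"
  using assms by (auto simp: mat_trace_def index_mult_mat_sum[OF assms] simp del: index_mult_mat(1) intro!: sum.cong)

lemma mat_trace_mult_commute:
  fixes A B :: "'a :: comm_semiring_0 mat"
  assumes "A \<in> carrier_mat n m" "B \<in> carrier_mat m n"
  shows "mat_trace (A * B) = mat_trace (B * A)"
  unfolding mat_trace_mult[OF assms] mat_trace_mult[OF assms(2,1)]
  by (subst sum.swap) (simp add: mult.commute)

lemma mat_trace_mult_adjoint:
  "mat_trace (A * mat_adjoint A) = complex_of_real ((frob_norm A)\<^sup>2)"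
proof -
  have "mat_trace (A * mat_adjoint A)
      = (\<Sum>i<dim_row A. \<Sum>k<dim_col A. A $$ (i, k) * mat_adjoint A $$ (k, i))"
    by (rule mat_trace_mult) auto
  then show ?thesis
    unfolding frob_norm_sq of_real_sum by (simp add: complex_norm_square flip: of_real_power)
qed

lemma mat_trace_unitary_conj:
  fixes A U :: "complex mat"
  assumes A: "A \<in> carrier_mat n n" and U: "U \<in> carrier_mat n n" and UU: "mat_adjoint U * U = 1\<^sub>m n"
  shows "mat_trace (mat_adjoint U * A * U) = mat_trace A"
proof -
  note U' = mat_adjoint_carrier[OF U]
  have UU': "U * mat_adjoint U = 1\<^sub>m n" by (rule mat_mult_left_right_inverse[OF U' U UU])
  have "mat_trace (mat_adjoint U * A * U) = mat_trace (U * (mat_adjoint U * A))"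
    by (rule mat_trace_mult_commute[of _ n n]) (use A U U' in auto)
  also have "U * (mat_adjoint U * A) = A"
    using A by (simp add: assoc_mult_mat[OF U U' A, symmetric] UU')
  finally show ?thesis .
qed

lemma unitary_conj_mult:
  fixes A B U :: "complex mat"
  assumes A: "A \<in> carrier_mat n n" and B: "B \<in> carrier_mat n n"
    and U: "U \<in> carrier_mat n n" and UU: "mat_adjoint U * U = 1\<^sub>m n"
  shows "(mat_adjoint U * A * U) * (mat_adjoint U * B * U) = mat_adjoint U * (A * B) * U"
proof -
  note U' = mat_adjoint_carrier[OF U]
  have UU': "U * mat_adjoint U = 1\<^sub>m n" by (rule mat_mult_left_right_inverse[OF U' U UU])
  note [simp] = assoc_mult_mat[of _ n n _ n _ n] mult_carrier_mat[of _ n n _ n]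
  have "(mat_adjoint U * A * U) * (mat_adjoint U * B * U)
      = mat_adjoint U * (A * ((U * mat_adjoint U) * (B * U)))"
    using A B U U' by simp
  then show ?thesis using A B U U' by (simp add: UU')
qed

lemma mat_adjoint_unitary_conj:
  fixes A U :: "complex mat"
  assumes A: "A \<in> carrier_mat n n" and U: "U \<in> carrier_mat n n"
  shows "mat_adjoint (mat_adjoint U * A * U) = mat_adjoint U * mat_adjoint A * U"
proof -
  note U' = mat_adjoint_carrier[OF U] and A' = mat_adjoint_carrier[OF A]
  have "mat_adjoint (mat_adjoint U * A * U) = mat_adjoint U * (mat_adjoint A * U)"
    using A U U' by (simp add: mat_adjoint_mult[of _ n n _ n] mult_carrier_mat[of _ n n _ n])
  then show ?thesis using A' U U' by (simp add: assoc_mult_mat[of _ n n _ n _ n])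
qed

lemma frob_norm_unitary_conj:
  fixes A U :: "complex mat"
  assumes A: "A \<in> carrier_mat n n" and U: "U \<in> carrier_mat n n" and UU: "mat_adjoint U * U = 1\<^sub>m n"
  shows "(frob_norm (mat_adjoint U * A * U))\<^sup>2 = (frob_norm A)\<^sup>2"
proof -
  note A' = mat_adjoint_carrier[OF A]
  have "complex_of_real ((frob_norm (mat_adjoint U * A * U))\<^sup>2)
      = mat_trace (mat_adjoint U * (A * mat_adjoint A) * U)"
    unfolding mat_trace_mult_adjoint[symmetric] mat_adjoint_unitary_conj[OF A U]
      unitary_conj_mult[OF A A' U UU] ..
  also have "\<dots> = complex_of_real ((frob_norm A)\<^sup>2)"
    using mat_trace_unitary_conj[OF mult_carrier_mat[OF A A'] U UU] by (simp add: mat_trace_mult_adjoint)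
  finally show ?thesis using of_real_eq_iff by blast
qed

section \<open>Departure from normality\<close>

definition self_commutator :: "complex mat \<Rightarrow> complex mat" where
  "self_commutator A = A * mat_adjoint A - mat_adjoint A * A"

lemma self_commutator_carrier [intro]:
  "A \<in> carrier_mat n n \<Longrightarrow> self_commutator A \<in> carrier_mat n n"
  unfolding self_commutator_def by (intro minus_carrier_mat mult_carrier_mat[of _ n n]) auto

lemma self_commutator_unitary_conj:
  fixes A U :: "complex mat"
  assumes A: "A \<in> carrier_mat n n" and U: "U \<in> carrier_mat n n" and UU: "mat_adjoint U * U = 1\<^sub>m n"
  shows "self_commutator (mat_adjoint U * A * U) = mat_adjoint U * self_commutator A * U"
proof -
  note U' = mat_adjoint_carrier[OF U] and A' = mat_adjoint_carrier[OF A]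
  have c: "A * mat_adjoint A \<in> carrier_mat n n" "mat_adjoint A * A \<in> carrier_mat n n"
    using A A' by auto
  show ?thesis
    unfolding self_commutator_def mat_adjoint_unitary_conj[OF A U]
      unitary_conj_mult[OF A A' U UU] unitary_conj_mult[OF A' A U UU]
    using c U U' 
    by (simp add: mult_minus_distrib_mat[of _ n n _ n] minus_mult_distrib_mat[of _ n n _ _ n] mult_carrier_mat[of _ n n _ n])
qed

lemma frob_norm_mult_le:
  fixes A B :: "complex mat"
  assumes A: "A \<in> carrier_mat n m" and B: "B \<in> carrier_mat m k"
  shows "(frob_norm (A * B))\<^sup>2 \<le> (frob_norm A)\<^sup>2 * (frob_norm B)\<^sup>2"
proof -
  have "(cmod ((A * B) $$ (i, j)))\<^sup>2
      \<le> (\<Sum>l<m. (cmod (A $$ (i, l)))\<^sup>2) * (\<Sum>l<m. (cmod (B $$ (l, j)))\<^sup>2)" 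
    if i: "i < n" and j: "j < k" for i j
  proof -
    have "cmod ((A * B) $$ (i, j)) \<le> (\<Sum>l<m. cmod (A $$ (i, l)) * cmod (B $$ (l, j)))"
      unfolding index_mult_mat_sum[OF A B i j] by (rule order_trans[OF norm_sum]) (simp add: norm_mult)
    then have "(cmod ((A * B) $$ (i, j)))\<^sup>2 \<le> (\<Sum>l<m. cmod (A $$ (i, l)) * cmod (B $$ (l, j)))\<^sup>2"
      by (rule power_mono) simp
    also have "\<dots> \<le> (\<Sum>l<m. (cmod (A $$ (i, l)))\<^sup>2) * (\<Sum>l<m. (cmod (B $$ (l, j)))\<^sup>2)"
      by (rule Cauchy_Schwarz_ineq_sum)
    finally show ?thesis .
  qed
  then have "(frob_norm (A * B))\<^sup>2
      \<le> (\<Sum>i<n. \<Sum>j<k. (\<Sum>l<m. (cmod (A $$ (i, l)))\<^sup>2) * (\<Sum>l<m. (cmod (B $$ (l, j)))\<^sup>2))"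
    unfolding frob_norm_sq using A B by (auto intro!: sum_mono)
  also have "\<dots> = (\<Sum>i<n. \<Sum>l<m. (cmod (A $$ (i, l)))\<^sup>2) * (\<Sum>j<k. \<Sum>l<m. (cmod (B $$ (l, j)))\<^sup>2)"
    by (simp add: sum_product)
  also have "(\<Sum>j<k. \<Sum>l<m. (cmod (B $$ (l, j)))\<^sup>2) = (frob_norm B)\<^sup>2"
    unfolding frob_norm_sq using B by (subst sum.swap) auto
  also have "(\<Sum>i<n. \<Sum>l<m. (cmod (A $$ (i, l)))\<^sup>2) = (frob_norm A)\<^sup>2"
    unfolding frob_norm_sq using A by auto
  finally show ?thesis .
qed

lemma frob_norm_mat_adjoint: 
  fixes A :: "complex mat" shows "(frob_norm (mat_adjoint A))\<^sup>2 = (frob_norm A)\<^sup>2"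
  unfolding frob_norm_sq by (subst sum.swap) simp

lemma frob_norm_diff_sq:
  fixes A B :: "complex mat"
  assumes A: "A \<in> carrier_mat n m" and B: "B \<in> carrier_mat n m"
  shows "(frob_norm (A - B))\<^sup>2
    = (frob_norm A)\<^sup>2 + (frob_norm B)\<^sup>2 - 2 * Re (mat_trace (A * mat_adjoint B))"
proof -
  have c: "(cmod (a - b))\<^sup>2 = (cmod a)\<^sup>2 + (cmod b)\<^sup>2 - 2 * Re (a * cnj b)" for a b
    unfolding cmod_power2 by (simp add: power2_eq_square algebra_simps)
  have "mat_trace (A * mat_adjoint B) = (\<Sum>i<n. \<Sum>k<m. A $$ (i, k) * cnj (B $$ (i, k)))"
    using A B by (subst mat_trace_mult[of _ n m]) auto
  then show ?thesis
    unfolding frob_norm_sq using A B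
    by (simp add: c sum.distrib sum_subtractf sum_distrib_left)
qed

text \<open>
  Expanding the square of \<open>A A\<^sup>* - A\<^sup>* A\<close> leaves the mixed term
  \<open>- 2 Re (tr (A A\<^sup>* A\<^sup>* A))\<close>. By cyclicity of the trace this is \<open>- 2\<close> times the squared norm
  of \<open>(A\<^sup>*)\<^sup>2\<close>, so it can be dropped, and submultiplicativity bounds each of the two squares.
  The constant is 2, where the triangle inequality would give 4.
\<close>

lemma frob_norm_self_commutator_le:
  assumes A: "A \<in> carrier_mat n n"
  shows "(frob_norm (self_commutator A))\<^sup>2 \<le> 2 * ((frob_norm A)\<^sup>2)\<^sup>2"
proof -
  let ?B = "mat_adjoint A"
  note B = mat_adjoint_carrier[OF A]
  note cc = mult_carrier_mat[of _ n n _ n]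
  have c: "A * ?B \<in> carrier_mat n n" "?B * A \<in> carrier_mat n n" using A B by auto
  have "mat_trace ((A * ?B) * mat_adjoint (?B * A)) = mat_trace (A * (?B * (?B * A)))"
    using A B c by (simp add: mat_adjoint_mult[OF B A] assoc_mult_mat[of _ n n _ n _ n])
  also have "\<dots> = mat_trace ((?B * (?B * A)) * A)"
    by (rule mat_trace_mult_commute[of _ n n]) (use A B c in \<open>auto intro: cc\<close>)
  also have "(?B * (?B * A)) * A = (?B * ?B) * mat_adjoint (?B * ?B)"
    using A B c by (simp add: mat_adjoint_mult[OF B B] assoc_mult_mat[of _ n n _ n _ n] cc)
  also have "mat_trace \<dots> = complex_of_real ((frob_norm (?B * ?B))\<^sup>2)"
    by (rule mat_trace_mult_adjoint)
  finally have "Re (mat_trace ((A * ?B) * mat_adjoint (?B * A))) \<ge> 0" by simp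
  then have "(frob_norm (self_commutator A))\<^sup>2 \<le> (frob_norm (A * ?B))\<^sup>2 + (frob_norm (?B * A))\<^sup>2"
    unfolding self_commutator_def frob_norm_diff_sq[OF c] by simp
  also have "\<dots> \<le> (frob_norm A)\<^sup>2 * (frob_norm A)\<^sup>2 + (frob_norm A)\<^sup>2 * (frob_norm A)\<^sup>2"
    using frob_norm_mult_le[OF A B] frob_norm_mult_le[OF B A] by (simp add: frob_norm_mat_adjoint)
  finally show ?thesis by (simp add: power2_eq_square)
qed

text \<open>
  Entry \<open>(i, j)\<close> of the self-commutator of \<open>D + N\<close>, where \<open>D\<close> is diagonal with entries \<open>d\<close>: the two
  contributions of \<open>D D\<^sup>*\<close> cancel, the mixed products only involve differences of diagonal
  entries, and the self-commutator of \<open>N\<close> remains.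
\<close>

lemma commutator_entry_diag_plus_offdiag:
  fixes d :: "nat \<Rightarrow> complex"
  assumes "i < n" "j < n"
  shows "(\<Sum>k<n. ((if i = k then d i else 0) + N i k) * cnj ((if j = k then d j else 0) + N j k))
      - (\<Sum>k<n. cnj ((if k = i then d k else 0) + N k i) * ((if k = j then d k else 0) + N k j))
    = ((d i - d j) * cnj (N j i) + N i j * (cnj (d j) - cnj (d i)))
      + ((\<Sum>k<n. N i k * cnj (N j k)) - (\<Sum>k<n. cnj (N k i) * N k j))"
proof -
  have 1: "((if i = k then d i else 0) + N i k) * cnj ((if j = k then d j else 0) + N j k)
      = (if k = i then (if j = i then d i * cnj (d j) else 0) + d i * cnj (N j k) else 0)
        + (if k = j then N i k * cnj (d j) else 0) + N i k * cnj (N j k)" for k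
    by (auto simp: algebra_simps)
  have 2: "cnj ((if k = i then d k else 0) + N k i) * ((if k = j then d k else 0) + N k j)
      = (if k = i then (if j = i then cnj (d i) * d j else 0) + cnj (d i) * N k j else 0)
        + (if k = j then cnj (N k i) * d j else 0) + cnj (N k i) * N k j" for k
    by (auto simp: algebra_simps)
  show ?thesis
    unfolding 1 2 sum.distrib using assms by (simp add: algebra_simps)
qed

text \<open>
  Eberlein's inequality. Write \<open>T = D + N\<close> with \<open>D\<close> diagonal and \<open>N\<close> strictly upper triangular, and
  let \<open>p\<close> and \<open>m\<close> be their squared Frobenius norms. The self-commutator of \<open>T\<close> is \<open>X + Y\<close>,
  where \<open>X\<close> collects the mixed products of \<open>D\<close> and \<open>N\<close> and \<open>Y\<close> is the self-commutator of \<open>N\<close>.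
  The squared norms of \<open>X\<close> and \<open>Y\<close> are at most \<open>4 p m\<close> and \<open>2 m\<^sup>2\<close>. A weighted parallelogram
  inequality combines them to \<open>6 m (p + m)\<close>, and \<open>p + m\<close> is the squared norm of \<open>T\<close>.
\<close>

theorem eberlein_upper_triangular:
  assumes T: "T \<in> carrier_mat n n" and tri: "upper_triangular T"
  shows "(frob_norm (self_commutator T))\<^sup>2
    \<le> 6 * (frob_norm T)\<^sup>2 * ((frob_norm T)\<^sup>2 - (\<Sum>i<n. (cmod (T $$ (i, i)))\<^sup>2))"
proof -
  define N where "N = mat n n (\<lambda>(i, j). if i = j then 0 else T $$ (i, j))"
  define d where "d i = T $$ (i, i)" for i
  define X where "X i j = (d i - d j) * cnj (N $$ (j, i)) + N $$ (i, j) * (cnj (d j) - cnj (d i))" for i j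
  define Y where "Y = self_commutator N"
  define p where "p = (\<Sum>i<n. (cmod (d i))\<^sup>2)"
  define m where "m = (frob_norm N)\<^sup>2"
  have N: "N \<in> carrier_mat n n" by (simp add: N_def)
  note N' = mat_adjoint_carrier[OF N] and T' = mat_adjoint_carrier[OF T]
  have Y: "Y \<in> carrier_mat n n" unfolding Y_def using N by auto
  have Tij: "T $$ (i, j) = (if i = j then d i else 0) + N $$ (i, j)" if "i < n" "j < n" for i j
    using that by (simp add: N_def d_def)
  have m_sum: "m = (\<Sum>i<n. \<Sum>j<n. (cmod (N $$ (i, j)))\<^sup>2)"
    unfolding m_def frob_norm_sq using N by simp
  have "(\<Sum>j<n. (cmod (T $$ (i, j)))\<^sup>2) = (cmod (d i))\<^sup>2 + (\<Sum>j<n. (cmod (N $$ (i, j)))\<^sup>2)"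
    if "i < n" for i
  proof -
    have "(\<Sum>j<n. (cmod (T $$ (i, j)))\<^sup>2)
        = (\<Sum>j<n. (if j = i then (cmod (d i))\<^sup>2 else 0) + (cmod (N $$ (i, j)))\<^sup>2)"
      by (intro sum.cong refl) (use that in \<open>auto simp: N_def d_def\<close>)
    then show ?thesis using that by (simp add: sum.distrib)
  qed
  then have Tpm: "(frob_norm T)\<^sup>2 = p + m"
    unfolding m_sum p_def frob_norm_sq using T by (simp add: sum.distrib)
  have pm0: "p \<ge> 0" "m \<ge> 0" by (auto simp: p_def m_def intro!: sum_nonneg)
  have X_le: "(cmod (X i j))\<^sup>2 \<le> 2 * p * ((cmod (N $$ (i, j)))\<^sup>2 + (cmod (N $$ (j, i)))\<^sup>2)"
    if i: "i < n" and j: "j < n" for i j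
  proof (cases "i = j")
    case True
    then show ?thesis using pm0 by (simp add: X_def)
  next
    case False
    have "(cmod (d i - d j))\<^sup>2 \<le> 2 * ((cmod (d i))\<^sup>2 + (cmod (d j))\<^sup>2)"
    proof -
      have "(cmod (d i - d j))\<^sup>2 \<le> (cmod (d i) + cmod (d j))\<^sup>2"
        by (rule power_mono[OF norm_triangle_ineq4]) simp
      also have "\<dots> \<le> 2 * ((cmod (d i))\<^sup>2 + (cmod (d j))\<^sup>2)"
        using sum_squares_bound[of "cmod (d i)" "cmod (d j)"] by (simp add: power2_sum)
      finally show ?thesis .
    qed
    also have "(cmod (d i))\<^sup>2 + (cmod (d j))\<^sup>2 \<le> p"
    proof -
      have "(\<Sum>k\<in>{i, j}. (cmod (d k))\<^sup>2) \<le> p"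
        unfolding p_def by (rule sum_mono2) (use i j in auto)
      then show ?thesis using False by simp
    qed
    finally have dp: "(cmod (d i - d j))\<^sup>2 \<le> 2 * p" by simp
    \<comment> \<open>Triangularity kills one of the two summands of \<open>X i j\<close>, so its square has no mixed term.\<close>
    have "N $$ (i, j) = 0 \<or> N $$ (j, i) = 0"
      using tri T i j False upper_triangularD[OF tri] by (auto simp: N_def neq_iff)
    moreover have "cmod (cnj (d j) - cnj (d i)) = cmod (d i - d j)"
      by (metis complex_cnj_diff complex_mod_cnj norm_minus_commute)
    ultimately have "(cmod (X i j))\<^sup>2 = (cmod (d i - d j))\<^sup>2 * ((cmod (N $$ (i, j)))\<^sup>2 + (cmod (N $$ (j, i)))\<^sup>2)"
      by (auto simp: X_def norm_mult power_mult_distrib)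
    also have "\<dots> \<le> 2 * p * ((cmod (N $$ (i, j)))\<^sup>2 + (cmod (N $$ (j, i)))\<^sup>2)"
      by (rule mult_right_mono[OF dp]) simp
    finally show ?thesis .
  qed
  have "(\<Sum>i<n. \<Sum>j<n. (cmod (X i j))\<^sup>2)
      \<le> (\<Sum>i<n. \<Sum>j<n. 2 * p * ((cmod (N $$ (i, j)))\<^sup>2 + (cmod (N $$ (j, i)))\<^sup>2))"
    by (intro sum_mono X_le) auto
  also have "\<dots> = 2 * p * (m + (\<Sum>i<n. \<Sum>j<n. (cmod (N $$ (j, i)))\<^sup>2))"
    unfolding m_sum by (simp add: sum.distrib sum_distrib_left algebra_simps)
  also have "(\<Sum>i<n. \<Sum>j<n. (cmod (N $$ (j, i)))\<^sup>2) = m"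
    unfolding m_sum by (rule sum.swap)
  finally have X2: "(\<Sum>i<n. \<Sum>j<n. (cmod (X i j))\<^sup>2) \<le> 4 * p * m" by simp
  have Y2: "(\<Sum>i<n. \<Sum>j<n. (cmod (Y $$ (i, j)))\<^sup>2) \<le> 2 * m\<^sup>2"
    using frob_norm_self_commutator_le[OF N] Y unfolding Y_def[symmetric] m_def frob_norm_sq[of Y] by simp
  have entry: "self_commutator T $$ (i, j) = X i j + Y $$ (i, j)" if i: "i < n" and j: "j < n" for i j
  proof -
    have sc: "self_commutator M $$ (i, j)
      = (\<Sum>k<n. M $$ (i, k) * cnj (M $$ (j, k))) - (\<Sum>k<n. cnj (M $$ (k, i)) * M $$ (k, j))"
      if M: "M \<in> carrier_mat n n" for M
      using M mat_adjoint_carrier[OF M] i j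
      by (simp add: self_commutator_def index_mult_mat_sum[of _ n n _ n] del: index_mult_mat(1))
    have "(\<Sum>k<n. T $$ (i, k) * cnj (T $$ (j, k)))
        = (\<Sum>k<n. ((if i = k then d i else 0) + N $$ (i, k)) * cnj ((if j = k then d j else 0) + N $$ (j, k)))"
      by (intro sum.cong refl) (use i j in \<open>simp only: Tij lessThan_iff\<close>)
    moreover have "(\<Sum>k<n. cnj (T $$ (k, i)) * T $$ (k, j))
        = (\<Sum>k<n. cnj ((if k = i then d k else 0) + N $$ (k, i)) * ((if k = j then d k else 0) + N $$ (k, j)))"
      by (intro sum.cong refl) (use i j in \<open>simp only: Tij lessThan_iff\<close>)
    ultimately show ?thesis
      using commutator_entry_diag_plus_offdiag[OF i j, of d "\<lambda>i j. N $$ (i, j)"]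
      unfolding X_def Y_def sc[OF N] sc[OF T] by simp
  qed
  \<comment> \<open>The weights \<open>3/2\<close> and \<open>3\<close> turn both bounds \<open>4 p m\<close> and \<open>2 m\<^sup>2\<close> into multiples of 6.\<close>
  have pt: "(cmod (x + y))\<^sup>2 \<le> 3 / 2 * (cmod x)\<^sup>2 + 3 * (cmod y)\<^sup>2" for x y
  proof -
    have "(cmod (x + y))\<^sup>2 \<le> (cmod x + cmod y)\<^sup>2"
      by (rule power_mono[OF norm_triangle_ineq]) simp
    also have "\<dots> \<le> 3 / 2 * (cmod x)\<^sup>2 + 3 * (cmod y)\<^sup>2"
      using zero_le_power2[of "cmod x - 2 * cmod y"] by (simp add: power2_eq_square algebra_simps)
    finally show ?thesis .
  qed
  have "(frob_norm (self_commutator T))\<^sup>2 = (\<Sum>i<n. \<Sum>j<n. (cmod (X i j + Y $$ (i, j)))\<^sup>2)"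
    unfolding frob_norm_sq using self_commutator_carrier[OF T] by (auto simp: entry)
  also have "\<dots> \<le> (\<Sum>i<n. \<Sum>j<n. 3 / 2 * (cmod (X i j))\<^sup>2 + 3 * (cmod (Y $$ (i, j)))\<^sup>2)"
    by (intro sum_mono pt)
  also have "\<dots> = 3 / 2 * (\<Sum>i<n. \<Sum>j<n. (cmod (X i j))\<^sup>2) + 3 * (\<Sum>i<n. \<Sum>j<n. (cmod (Y $$ (i, j)))\<^sup>2)"
    by (simp only: sum.distrib sum_distrib_left)
  also have "\<dots> \<le> 3 / 2 * (4 * p * m) + 3 * (2 * m\<^sup>2)"
    using X2 Y2 by linarith
  also have "\<dots> = 6 * (p + m) * ((p + m) - p)" by (simp add: power2_eq_square algebra_simps)
  finally show ?thesis unfolding Tpm p_def d_def .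
qed

text \<open>
  The eigenvalues with multiplicity, read off the diagonal of a Schur form. All the quantities
  involved are invariant under unitary conjugation, so Eberlein's inequality for the triangular
  form holds for \<open>A\<close>. The last conclusion, Schur's inequality, is kept separately: it does not
  follow from Eberlein's inequality when \<open>A = 0\<close>, since both sides of the latter then vanish.
\<close>

theorem eigenvalue_enumeration:
  fixes A :: "complex mat"
  assumes A: "A \<in> carrier_mat n n"
  obtains d :: "nat \<Rightarrow> complex" where "spectrum A = d ` {..<n}"
    "mat_trace A = (\<Sum>i<n. d i)" "mat_trace (A * A) = (\<Sum>i<n. (d i)\<^sup>2)"
    "(frob_norm (self_commutator A))\<^sup>2
      \<le> 6 * (frob_norm A)\<^sup>2 * ((frob_norm A)\<^sup>2 - (\<Sum>i<n. (cmod (d i))\<^sup>2))"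
    "(\<Sum>i<n. (cmod (d i))\<^sup>2) \<le> (frob_norm A)\<^sup>2"
proof -
  obtain U where U: "U \<in> carrier_mat n n" and UU: "mat_adjoint U * U = 1\<^sub>m n"
    and tri: "upper_triangular (mat_adjoint U * A * U)" using unitary_schur[OF A] by blast
  note U' = mat_adjoint_carrier[OF U]
  have UU': "U * mat_adjoint U = 1\<^sub>m n" by (rule mat_mult_left_right_inverse[OF U' U UU])
  define T where "T = mat_adjoint U * A * U"
  have T: "T \<in> carrier_mat n n" unfolding T_def using A U U' by auto
  note tri = tri[folded T_def]
  define d where "d i = T $$ (i, i)" for i
  have "similar_mat_wit T A (mat_adjoint U) U"
    by (rule similar_mat_witI[OF UU UU' T_def T A U' U])
  then have "char_poly A = char_poly T"
    by (metis char_poly_similar similar_mat_def)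
  also have "\<dots> = (\<Prod>a \<leftarrow> diag_mat T. [:- a, 1:])"
    by (rule char_poly_upper_triangular[OF T tri])
  finally have "spectrum A = {k. poly (\<Prod>a \<leftarrow> diag_mat T. [:- a, 1:]) k = 0}"
    using spectrum_root_char_poly[OF A] by simp
  also have "\<dots> = d ` {..<n}"
    using T by (auto simp: poly_prod_list prod_list_zero_iff diag_mat_def d_def)
  finally have sp: "spectrum A = d ` {..<n}" .
  have tr: "mat_trace A = (\<Sum>i<n. d i)"
    using mat_trace_unitary_conj[OF A U UU] T unfolding T_def[symmetric] by (simp add: mat_trace_def d_def)
  have "mat_trace (A * A) = mat_trace (T * T)"
    using mat_trace_unitary_conj[OF mult_carrier_mat[OF A A] U UU] unitary_conj_mult[OF A A U UU]
    by (simp add: T_def)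
  also have "\<dots> = (\<Sum>i<n. \<Sum>k<n. if k = i then (d i)\<^sup>2 else 0)"
    unfolding mat_trace_mult[OF T T]
  proof (intro sum.cong refl)
    fix i k assume "i \<in> {..<n}" "k \<in> {..<n}"
    then show "T $$ (i, k) * T $$ (k, i) = (if k = i then (d i)\<^sup>2 else 0)"
      using upper_triangularD[OF tri, of i k] upper_triangularD[OF tri, of k i] T
      by (cases i k rule: linorder_cases) (auto simp: d_def power2_eq_square)
  qed
  also have "\<dots> = (\<Sum>i<n. (d i)\<^sup>2)" by simp
  finally have tr2: "mat_trace (A * A) = (\<Sum>i<n. (d i)\<^sup>2)" .
  have fr: "(frob_norm T)\<^sup>2 = (frob_norm A)\<^sup>2"
    unfolding T_def by (rule frob_norm_unitary_conj[OF A U UU])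
  have "(frob_norm (self_commutator T))\<^sup>2 = (frob_norm (self_commutator A))\<^sup>2"
    unfolding T_def self_commutator_unitary_conj[OF A U UU]
    by (rule frob_norm_unitary_conj[OF self_commutator_carrier[OF A] U UU])
  with eberlein_upper_triangular[OF T tri] fr
  have eb: "(frob_norm (self_commutator A))\<^sup>2
      \<le> 6 * (frob_norm A)\<^sup>2 * ((frob_norm A)\<^sup>2 - (\<Sum>i<n. (cmod (d i))\<^sup>2))"
    by (simp add: d_def)
  have "(\<Sum>i<n. (cmod (d i))\<^sup>2) \<le> (\<Sum>i<n. \<Sum>j<n. (cmod (T $$ (i, j)))\<^sup>2)"
    unfolding d_def by (intro sum_mono member_le_sum) auto
  then have "(\<Sum>i<n. (cmod (d i))\<^sup>2) \<le> (frob_norm A)\<^sup>2"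
    unfolding fr[symmetric] unfolding frob_norm_sq using T by simp
  from that[OF sp tr tr2 eb this] show ?thesis .
qed

section \<open>Deviation of one number from the mean\<close>

text \<open>
  The Laguerre-Samuelson inequality. The deviations \<open>y\<close> from the mean sum to zero, so \<open>y k\<close> is,
  up to sign, the sum of the other \<open>n - 1\<close> deviations, and Cauchy-Schwarz applies to that sum.
\<close>

lemma laguerre_samuelson:
  fixes x :: "nat \<Rightarrow> real"
  assumes k: "k < n"
  shows "(x k - (\<Sum>i<n. x i) / n)\<^sup>2
    \<le> (real n - 1) / n * ((\<Sum>i<n. (x i)\<^sup>2) - (\<Sum>i<n. x i)\<^sup>2 / n)"
proof -
  define s where "s = (\<Sum>i<n. x i)"
  define y where "y i = x i - s / n" for i
  have n: "real n > 0" using k by simp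
  have y0: "(\<Sum>i<n. y i) = 0" using n by (simp add: y_def sum_subtractf s_def)
  have "(\<Sum>i<n. (y i)\<^sup>2) = (\<Sum>i<n. (x i)\<^sup>2) - 2 * (s / n) * s + n * (s / n)\<^sup>2"
  proof -
    have "(y i)\<^sup>2 = (x i)\<^sup>2 - 2 * (s / n) * x i + (s / n)\<^sup>2" for i
      by (simp add: y_def power2_diff)
    then show ?thesis
      by (simp only: sum.distrib sum_subtractf s_def sum_distrib_left[symmetric]) simp
  qed
  also have "\<dots> = (\<Sum>i<n. (x i)\<^sup>2) - s\<^sup>2 / n"
    using n by (simp add: power2_eq_square field_simps)
  finally have y2: "(\<Sum>i<n. (y i)\<^sup>2) = (\<Sum>i<n. (x i)\<^sup>2) - s\<^sup>2 / n" .
  let ?K = "{..<n} - {k}"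
  have split: "(\<Sum>i<n. f i) = f k + (\<Sum>i\<in>?K. f i)" for f :: "nat \<Rightarrow> real"
    using k by (simp add: sum.remove)
  have "(y k)\<^sup>2 = (\<Sum>i\<in>?K. y i * 1)\<^sup>2"
    using y0 split[of y] by (simp add: power2_eq_iff)
  also have "\<dots> \<le> (\<Sum>i\<in>?K. (y i)\<^sup>2) * (\<Sum>i\<in>?K. 1\<^sup>2)"
    by (rule Cauchy_Schwarz_ineq_sum)
  also have "\<dots> = ((\<Sum>i<n. (y i)\<^sup>2) - (y k)\<^sup>2) * (real n - 1)"
    using split[of "\<lambda>i. (y i)\<^sup>2"] k by (simp add: of_nat_diff)
  finally have "real n * (y k)\<^sup>2 \<le> (real n - 1) * (\<Sum>i<n. (y i)\<^sup>2)"
    by (simp add: algebra_simps)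
  then have "(y k)\<^sup>2 \<le> (real n - 1) / n * (\<Sum>i<n. (y i)\<^sup>2)"
    using n by (simp add: field_simps)
  then show ?thesis unfolding y2 unfolding y_def s_def .
qed

section \<open>Combinations of a symmetric and a skew-symmetric matrix\<close>

text \<open>
  The Frobenius norm, the trace of the square and the self-commutator of
  \<open>L = \<alpha> H + \<beta> S\<close> in terms of \<open>H\<close> and \<open>S\<close>. Everything rests on \<open>L\<^sup>* = \<alpha> H - \<beta> S\<close> and on the
  orthogonality of symmetric and skew-symmetric matrices.
\<close>

locale sym_skew_pair =
  fixes H S :: "real mat" and n :: nat and \<alpha> \<beta> :: real
  assumes H: "H \<in> carrier_mat n n" and S: "S \<in> carrier_mat n n"
    and sym: "\<And>i j. i < n \<Longrightarrow> j < n \<Longrightarrow> H $$ (j, i) = H $$ (i, j)"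
    and skew: "\<And>i j. i < n \<Longrightarrow> j < n \<Longrightarrow> S $$ (j, i) = - S $$ (i, j)"
begin

definition L :: "complex mat" where
  "L = map_mat complex_of_real (\<alpha> \<cdot>\<^sub>m H + \<beta> \<cdot>\<^sub>m S)"

lemma L_carrier: "L \<in> carrier_mat n n"
  using H S by (auto simp: L_def)

lemma L_index: "i < n \<Longrightarrow> j < n \<Longrightarrow> L $$ (i, j) = complex_of_real (\<alpha> * H $$ (i, j) + \<beta> * S $$ (i, j))"
  using H S by (simp add: L_def)

lemma inner_eq_0: "(\<Sum>i<n. \<Sum>j<n. H $$ (i, j) * S $$ (i, j)) = 0"
proof -
  have "(\<Sum>i<n. \<Sum>j<n. H $$ (i, j) * S $$ (i, j)) = (\<Sum>i<n. \<Sum>j<n. H $$ (j, i) * S $$ (j, i))"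
    by (rule sum.swap)
  also have "\<dots> = (\<Sum>i<n. \<Sum>j<n. - (H $$ (i, j) * S $$ (i, j)))"
  proof (intro sum.cong refl)
    fix i j assume "i \<in> {..<n}" "j \<in> {..<n}"
    then have ij: "i < n" "j < n" by auto
    show "H $$ (j, i) * S $$ (j, i) = - (H $$ (i, j) * S $$ (i, j))"
      unfolding sym[OF ij] skew[OF ij] by simp
  qed
  finally show ?thesis by (simp add: sum_negf)
qed

lemma frob_norm_L: "(frob_norm L)\<^sup>2 = \<alpha>\<^sup>2 * (frob_norm H)\<^sup>2 + \<beta>\<^sup>2 * (frob_norm S)\<^sup>2"
proof -
  have "(frob_norm L)\<^sup>2 = (\<Sum>i<n. \<Sum>j<n. (\<alpha> * H $$ (i, j) + \<beta> * S $$ (i, j))\<^sup>2)"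
    unfolding frob_norm_sq using L_carrier by (simp add: L_index norm_of_real del: of_real_add of_real_mult)
  also have "\<dots> = (\<Sum>i<n. \<Sum>j<n. \<alpha>\<^sup>2 * (H $$ (i, j))\<^sup>2 + \<beta>\<^sup>2 * (S $$ (i, j))\<^sup>2
      + 2 * \<alpha> * \<beta> * (H $$ (i, j) * S $$ (i, j)))"
    by (simp add: power2_eq_square algebra_simps)
  also have "\<dots> = \<alpha>\<^sup>2 * (frob_norm H)\<^sup>2 + \<beta>\<^sup>2 * (frob_norm S)\<^sup>2
      + 2 * \<alpha> * \<beta> * (\<Sum>i<n. \<Sum>j<n. H $$ (i, j) * S $$ (i, j))"
    unfolding frob_norm_sq using H S by (simp add: sum.distrib flip: sum_distrib_left)
  finally show ?thesis by (simp add: inner_eq_0)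
qed

lemma trace_L_square:
  "mat_trace (L * L) = complex_of_real (\<alpha>\<^sup>2 * (frob_norm H)\<^sup>2 - \<beta>\<^sup>2 * (frob_norm S)\<^sup>2)"
proof -
  have "mat_trace (L * L) = (\<Sum>i<n. \<Sum>j<n. complex_of_real (\<alpha>\<^sup>2 * (H $$ (i, j))\<^sup>2 - \<beta>\<^sup>2 * (S $$ (i, j))\<^sup>2))"
    unfolding mat_trace_mult[OF L_carrier L_carrier]
  proof (intro sum.cong refl)
    fix i j assume "i \<in> {..<n}" "j \<in> {..<n}"
    then have ij: "i < n" "j < n" by auto
    show "L $$ (i, j) * L $$ (j, i) = complex_of_real (\<alpha>\<^sup>2 * (H $$ (i, j))\<^sup>2 - \<beta>\<^sup>2 * (S $$ (i, j))\<^sup>2)"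
      unfolding L_index[OF ij] L_index[OF ij(2,1)] sym[OF ij] skew[OF ij] of_real_mult[symmetric]
      by (simp add: power2_eq_square algebra_simps)
  qed
  also have "\<dots> = complex_of_real (\<Sum>i<n. \<Sum>j<n. \<alpha>\<^sup>2 * (H $$ (i, j))\<^sup>2 - \<beta>\<^sup>2 * (S $$ (i, j))\<^sup>2)"
    by simp
  finally show ?thesis
    unfolding frob_norm_sq using H S by (simp add: sum_subtractf flip: sum_distrib_left)
qed

lemma trace_L: "mat_trace L = complex_of_real (\<alpha> * mat_trace H)"
proof -
  have "S $$ (i, i) = 0" if "i < n" for i using skew[OF that that] by simp
  then show ?thesis using H S by (simp add: L_def mat_trace_def sum_distrib_left)
qed

lemma frob_norm_commutator_L:
  "(frob_norm (self_commutator L))\<^sup>2 = 4 * \<alpha>\<^sup>2 * \<beta>\<^sup>2 * (frob_norm (S * H - H * S))\<^sup>2"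
proof -
  have c: "S * H \<in> carrier_mat n n" "H * S \<in> carrier_mat n n" using H S by auto
  have L': "mat_adjoint L \<in> carrier_mat n n" using L_carrier by blast
  have "self_commutator L $$ (i, j) = complex_of_real (2 * \<alpha> * \<beta> * (S * H - H * S) $$ (i, j))"
    if i: "i < n" and j: "j < n" for i j
  proof -
    have "self_commutator L $$ (i, j)
        = (\<Sum>k<n. L $$ (i, k) * mat_adjoint L $$ (k, j)) - (\<Sum>k<n. mat_adjoint L $$ (i, k) * L $$ (k, j))"
      unfolding self_commutator_def
      using L_carrier L' i j index_mult_mat_sum[OF L_carrier L' i j] index_mult_mat_sum[OF L' L_carrier i j]
      by (simp del: index_mult_mat(1))
    also have "\<dots> = (\<Sum>k<n. L $$ (i, k) * mat_adjoint L $$ (k, j) - mat_adjoint L $$ (i, k) * L $$ (k, j))"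
      by (simp only: sum_subtractf)
    also have "\<dots> = (\<Sum>k<n. complex_of_real (2 * \<alpha> * \<beta> * (S $$ (i, k) * H $$ (k, j) - H $$ (i, k) * S $$ (k, j))))"
    proof (intro sum.cong refl)
      fix k assume "k \<in> {..<n}"
      then have k: "k < n" by simp
      have adj: "mat_adjoint L $$ (k, j) = complex_of_real (\<alpha> * H $$ (k, j) - \<beta> * S $$ (k, j))"
        "mat_adjoint L $$ (i, k) = complex_of_real (\<alpha> * H $$ (i, k) - \<beta> * S $$ (i, k))"
        using L_carrier i j k sym[OF k j] skew[OF k j] sym[OF i k] skew[OF i k] by (simp_all add: L_index)
      show "L $$ (i, k) * mat_adjoint L $$ (k, j) - mat_adjoint L $$ (i, k) * L $$ (k, j)
          = complex_of_real (2 * \<alpha> * \<beta> * (S $$ (i, k) * H $$ (k, j) - H $$ (i, k) * S $$ (k, j)))"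
        unfolding adj L_index[OF i k] L_index[OF k j] of_real_mult[symmetric] of_real_diff[symmetric]
        by (simp add: algebra_simps)
    qed
    also have "\<dots> = complex_of_real (2 * \<alpha> * \<beta>
        * ((\<Sum>k<n. S $$ (i, k) * H $$ (k, j)) - (\<Sum>k<n. H $$ (i, k) * S $$ (k, j))))"
      by (simp only: of_real_sum[symmetric] sum_distrib_left[symmetric] sum_subtractf)
    also have "(\<Sum>k<n. S $$ (i, k) * H $$ (k, j)) - (\<Sum>k<n. H $$ (i, k) * S $$ (k, j)) = (S * H - H * S) $$ (i, j)"
      using c i j H S index_mult_mat_sum[OF S H i j] index_mult_mat_sum[OF H S i j]
      by (simp del: index_mult_mat(1))
    finally show ?thesis .
  qed
  then have "(frob_norm (self_commutator L))\<^sup>2 = (\<Sum>i<n. \<Sum>j<n. (2 * \<alpha> * \<beta> * (S * H - H * S) $$ (i, j))\<^sup>2)"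
    unfolding frob_norm_sq using self_commutator_carrier[OF L_carrier] 
    by (auto simp: norm_of_real simp del: of_real_mult)
  also have "\<dots> = 4 * \<alpha>\<^sup>2 * \<beta>\<^sup>2 * (frob_norm (S * H - H * S))\<^sup>2"
    unfolding frob_norm_sq power_mult_distrib using H S 
    by (simp add: sum_distrib_left del: index_minus_mat(1))
  finally show ?thesis .
qed

end

section \<open>Bounds for the eigenvalues of the generalized Levinger transformation\<close>

theorem theorem1:
  fixes A :: "real mat" and n :: nat and \<alpha> \<beta> :: real and \<mu> :: complex
  defines "H \<equiv> herm_part A" and "S \<equiv> skew_part A"
  assumes "A \<in> carrier_mat n n"
    and "\<mu> \<in> complex_spectrum (levinger A \<alpha> \<beta>)"
  shows "\<bar>Re \<mu> - \<alpha> * mat_trace H / real n\<bar>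
      \<le> \<bar>\<alpha>\<bar> * sqrt ((real n - 1) / real n *
          ((frob_norm H)\<^sup>2
            - \<beta>\<^sup>2 * (frob_norm (S * H - H * S))\<^sup>2
                / (3 * (\<alpha>\<^sup>2 * (frob_norm H)\<^sup>2 + \<beta>\<^sup>2 * (frob_norm S)\<^sup>2))
            - (mat_trace H)\<^sup>2 / real n))
    \<and> \<bar>Im \<mu>\<bar>
      \<le> \<bar>\<beta>\<bar> * sqrt ((real n - 1) / real n *
          ((frob_norm S)\<^sup>2
            - \<alpha>\<^sup>2 * (frob_norm (S * H - H * S))\<^sup>2
                / (3 * (\<alpha>\<^sup>2 * (frob_norm H)\<^sup>2 + \<beta>\<^sup>2 * (frob_norm S)\<^sup>2))))"
proof -
  have A: "A \<in> carrier_mat n n" by fact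
  interpret sym_skew_pair H S n \<alpha> \<beta>
    by unfold_locales (use A in \<open>auto simp: H_def S_def herm_part_def skew_part_def field_simps\<close>)
  define h s c where "h = (frob_norm H)\<^sup>2" and "s = (frob_norm S)\<^sup>2"
    and "c = (frob_norm (S * H - H * S))\<^sup>2"
  define t where "t = mat_trace H"
  define q where "q = \<alpha>\<^sup>2 * h + \<beta>\<^sup>2 * s"
  note defs = h_def[symmetric] s_def[symmetric] c_def[symmetric]
  obtain d where sp: "spectrum L = d ` {..<n}" and tr: "mat_trace L = (\<Sum>i<n. d i)"
    and tr2: "mat_trace (L * L) = (\<Sum>i<n. (d i)\<^sup>2)"
    and eb: "(frob_norm (self_commutator L))\<^sup>2
      \<le> 6 * (frob_norm L)\<^sup>2 * ((frob_norm L)\<^sup>2 - (\<Sum>i<n. (cmod (d i))\<^sup>2))"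
    and dle: "(\<Sum>i<n. (cmod (d i))\<^sup>2) \<le> (frob_norm L)\<^sup>2"
    by (rule eigenvalue_enumeration[OF L_carrier])
  have "\<mu> \<in> spectrum L"
    unfolding L_def using assms(4) by (simp add: complex_spectrum_def levinger_def H_def S_def)
  with sp obtain k where k: "k < n" and \<mu>: "\<mu> = d k" by auto
  define R where "R = (\<Sum>i<n. (Re (d i))\<^sup>2)"
  define J where "J = (\<Sum>i<n. (Im (d i))\<^sup>2)"
  \<comment> \<open>The trace of \<open>L\<^sup>2\<close> gives \<open>R - J\<close> exactly, and Eberlein's inequality bounds \<open>R + J\<close>.\<close>
  have RJ: "(\<Sum>i<n. (cmod (d i))\<^sup>2) = R + J"
    by (simp add: R_def J_def cmod_power2 sum.distrib)
  have "Re (\<Sum>i<n. (d i)\<^sup>2) = R - J"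
    by (simp add: R_def J_def power2_eq_square sum_subtractf)
  then have diff: "R - J = \<alpha>\<^sup>2 * h - \<beta>\<^sup>2 * s"
    using tr2 unfolding trace_L_square defs by (metis Re_complex_of_real)
  have tot: "R + J \<le> q" and eb': "4 * \<alpha>\<^sup>2 * \<beta>\<^sup>2 * c \<le> 6 * q * (q - (R + J))"
    using dle eb unfolding RJ frob_norm_L frob_norm_commutator_L defs q_def by auto
  have q0: "q \<ge> 0" by (simp add: q_def h_def s_def)
  \<comment> \<open>If \<open>q = 0\<close>, the quotient is zero by convention and Schur's inequality takes over.\<close>
  have gap: "\<alpha>\<^sup>2 * \<beta>\<^sup>2 * c / (3 * q) \<le> (q - (R + J)) / 2"
  proof (cases "q = 0")
    case True
    then show ?thesis using tot by simp
  next
    case False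
    then show ?thesis using eb' q0 by (simp add: field_simps)
  qed
  have sumRe: "(\<Sum>i<n. Re (d i)) = \<alpha> * t" and sumIm: "(\<Sum>i<n. Im (d i)) = 0"
    using tr unfolding trace_L t_def by (metis Re_complex_of_real Re_sum, metis Im_complex_of_real Im_sum)
  have n: "(real n - 1) / n \<ge> 0" using k by simp
  have Re_bound: "(Re \<mu> - \<alpha> * t / n)\<^sup>2
      \<le> \<alpha>\<^sup>2 * ((real n - 1) / n * (h - \<beta>\<^sup>2 * c / (3 * q) - t\<^sup>2 / n))"
  proof -
    have "(Re \<mu> - \<alpha> * t / n)\<^sup>2 \<le> (real n - 1) / n * (R - (\<alpha> * t)\<^sup>2 / n)"
      using laguerre_samuelson[OF k, of "\<lambda>i. Re (d i)"] unfolding sumRe R_def[symmetric] \<mu> .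
    also have "\<dots> \<le> (real n - 1) / n * (\<alpha>\<^sup>2 * h - \<alpha>\<^sup>2 * \<beta>\<^sup>2 * c / (3 * q) - (\<alpha> * t)\<^sup>2 / n)"
      by (rule mult_left_mono[OF _ n]) (use gap diff in \<open>simp add: q_def\<close>)
    finally show ?thesis by (simp add: power_mult_distrib algebra_simps)
  qed
  have Im_bound: "(Im \<mu>)\<^sup>2 \<le> \<beta>\<^sup>2 * ((real n - 1) / n * (s - \<alpha>\<^sup>2 * c / (3 * q)))"
  proof -
    have "(Im \<mu>)\<^sup>2 \<le> (real n - 1) / n * J"
      using laguerre_samuelson[OF k, of "\<lambda>i. Im (d i)"] unfolding sumIm J_def[symmetric] \<mu> by simp
    also have "\<dots> \<le> (real n - 1) / n * (\<beta>\<^sup>2 * s - \<alpha>\<^sup>2 * \<beta>\<^sup>2 * c / (3 * q))"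
      by (rule mult_left_mono[OF _ n]) (use gap diff in \<open>simp add: q_def\<close>)
    finally show ?thesis by (simp add: algebra_simps)
  qed
  have sqrt_bound: "\<bar>x\<bar> \<le> \<bar>a\<bar> * sqrt z" if "x\<^sup>2 \<le> a\<^sup>2 * z" for x a z :: real
    using real_sqrt_le_mono[OF that] by (simp add: real_sqrt_mult)
  from sqrt_bound[OF Re_bound] sqrt_bound[OF Im_bound] show ?thesis
    unfolding q_def t_def defs by blast
qed

end
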